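(* Let $(a_n)_{n\ge 1}$ be a sequence of real numbers such that $a_n\to 0$. Then $$\dim\left\{\varepsilon=(\varepsilon_n)_{n\ge1} \in \Omega:\ \sum_{n=1}^\infty \varepsilon_n a_n \text{ is convergent} \right\}=1.$$
   Context: $\Omega=\{-1,1\}^{\mathbb{N}}$ (with $\mathbb{N}=\{1,2,\dots\}$) is the set of infinite sign sequences, equipped with the ultrametric $\rho(\varepsilon,\omega)=2^{-\min\{n:\ \varepsilon_n\neq\omega_n\}}$ for $\varepsilon\ne\omega$, and $\rho(\varepsilon,\varepsilon)=0$. $\dim$ denotes Hausdorff dimension of subsets of $(\Omega,\rho)$. Convergence of a series means convergence of its sequence of partial sums. *)

theory Defs
  imports "HOL-Analysis.Analysis"
begin

context Metric_space
begin

text \<open>The diameter takes values in the extended non-negative reals; the empty set has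
  diameter \<^term>\<open>0\<close> (the supremum of the empty set).\<close>

definition mdiam :: "'a set \<Rightarrow> ennreal" where
  "mdiam U = (SUP x\<in>U. SUP y\<in>U. ennreal (d x y))"

text \<open>The number \<open>(diam U)\<^sup>s\<close>, for a set \<open>U\<close> of finite diameter and \<open>s \<ge> 0\<close>. The case
  distinction is needed because \<^term>\<open>(0::real) powr 0 = 0\<close> in HOL: for \<open>s = 0\<close> every nonempty
  set, in particular a singleton, counts as 1, and the empty set always counts as 0.\<close>

definition mdiam_pow :: "real \<Rightarrow> 'a set \<Rightarrow> ennreal" where
  "mdiam_pow s U =
     (if U = {} then 0 else if s = 0 then 1 else ennreal (enn2real (mdiam U) powr s))"

text \<open>Finite covers are included among the sequences \<open>U\<close>, since the \<open>U i\<close> may be empty.\<close>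

definition hausdorff_premeasure :: "real \<Rightarrow> real \<Rightarrow> 'a set \<Rightarrow> ennreal" where
  "hausdorff_premeasure s \<delta> A =
     (INF U \<in> {U :: nat \<Rightarrow> 'a set. A \<subseteq> (\<Union>i. U i) \<and> (\<forall>i. U i \<subseteq> M \<and> mdiam (U i) \<le> ennreal \<delta>)}.
        \<Sum>i. mdiam_pow s (U i))"

definition hausdorff_measure :: "real \<Rightarrow> 'a set \<Rightarrow> ennreal" where
  "hausdorff_measure s A = (SUP \<delta>\<in>{0<..}. hausdorff_premeasure s \<delta> A)"

definition hausdorff_dim :: "'a set \<Rightarrow> ennreal" where
  "hausdorff_dim A = Inf {ennreal s | s. 0 \<le> s \<and> hausdorff_measure s A = 0}"

end

text \<open>Sign sequences are indexed by the positive integers. They are represented as extensional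
  functions (with the fixed value \<^term>\<open>undefined\<close> at the index 0), so that equality of
  functions is equality of sequences.\<close>

definition sign_sequences :: "(nat \<Rightarrow> real) set" where
  "sign_sequences = {1..} \<rightarrow>\<^sub>E {-1, 1}"

definition sign_dist :: "(nat \<Rightarrow> real) \<Rightarrow> (nat \<Rightarrow> real) \<Rightarrow> real" where
  "sign_dist \<epsilon> \<omega> =
     (if \<epsilon> = \<omega> then 0 else 2 powr - real (LEAST n. n \<ge> 1 \<and> \<epsilon> n \<noteq> \<omega> n))"

lemma sign_dist_commute: "sign_dist x y = sign_dist y x"
proof -
  have "(\<lambda>n. n \<ge> 1 \<and> x n \<noteq> y n) = (\<lambda>n. n \<ge> 1 \<and> y n \<noteq> x n)" by auto
  then show ?thesis unfolding sign_dist_def by auto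
qed

lemma sign_dist_ultrametric:
  assumes "x \<in> sign_sequences" "z \<in> sign_sequences"
  shows "sign_dist x z \<le> max (sign_dist x y) (sign_dist y z)"
proof (cases "x = y \<or> y = z \<or> x = z")
  case True
  then show ?thesis by (auto simp: sign_dist_def le_max_iff_disj)
next
  case False
  define n where "n = (LEAST n. n \<ge> 1 \<and> x n \<noteq> z n)"
  have "\<exists>n. n \<ge> 1 \<and> x n \<noteq> z n"
  proof (rule ccontr)
    assume "\<not> ?thesis"
    then have "x = z"
      using assms unfolding sign_sequences_def by (intro PiE_ext[of x _ _ z]) auto
    then show False using False by simp
  qed
  then have n: "n \<ge> 1 \<and> x n \<noteq> z n"
    unfolding n_def by (rule LeastI_ex)
  have *: "2 powr - real n \<le> sign_dist u v" if "u \<noteq> v" "u n \<noteq> v n" for u v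
  proof -
    have "(LEAST n. n \<ge> 1 \<and> u n \<noteq> v n) \<le> n"
      using n that by (intro Least_le) auto
    then show ?thesis using that by (simp add: sign_dist_def)
  qed
  have "sign_dist x z = 2 powr - real n"
    using False by (simp add: sign_dist_def n_def)
  moreover have "x n \<noteq> y n \<or> y n \<noteq> z n" using n by auto
  ultimately show ?thesis using * False by (metis max.coboundedI1 max.coboundedI2)
qed

lemma Metric_space_sign_sequences: "Metric_space sign_sequences sign_dist"
proof
  show nonneg: "0 \<le> sign_dist x y" for x y by (simp add: sign_dist_def)
  show "sign_dist x y = sign_dist y x" for x y by (rule sign_dist_commute)
  show "sign_dist x y = 0 \<longleftrightarrow> x = y" for x y by (simp add: sign_dist_def)
  show "sign_dist x z \<le> sign_dist x y + sign_dist y z"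
    if "x \<in> sign_sequences" "y \<in> sign_sequences" "z \<in> sign_sequences" for x y z
    using sign_dist_ultrametric[OF that(1,3), of y] nonneg[of x y] nonneg[of y z] by linarith
qed

interpretation sign_seq: Metric_space sign_sequences sign_dist
  by (rule Metric_space_sign_sequences)

end

theory Submission
  imports Defs
begin

text \<open>For the lower bound, divide the indices into blocks of length \<open>q + 1\<close>. Choose the signs
  in a block freely, except that the first one is 1, and then flip the whole block if necessary, so
  that the block sum is opposite in sign to the partial sum before it. Block sums tend to 0, so
  these partial sums converge: either from some point on they never jump over 0 and are monotone,
  or they jump over 0 infinitely often and tend to 0. Only one sign per block is lost. Taking the
  free signs to be the binary digits of \<open>x \<in> [0,1)\<close> and transporting Lebesgue
  measure gives dimension at least \<open>q / (q + 1)\<close>, for every \<open>q\<close>.\<close>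

section \<open>Convergence of partial sums, first along blocks and then along all indices\<close>

lemma convergent_opposing_increments:
  fixes S X :: "nat \<Rightarrow> real"
  assumes step: "\<And>k. S (Suc k) = S k + X k"
    and opp: "\<And>k. S k * X k \<le> 0"
    and X: "X \<longlonglongrightarrow> 0"
  shows "convergent S"
proof (cases "\<exists>k0. \<forall>k\<ge>k0. \<bar>X k\<bar> \<le> \<bar>S k\<bar>")
  case True
  then obtain k0 where k0: "\<And>k. k \<ge> k0 \<Longrightarrow> \<bar>X k\<bar> \<le> \<bar>S k\<bar>" by blast
  \<comment> \<open>Stated for general \<open>T\<close> and \<open>Z\<close> so that it can be
    applied to \<open>S\<close> or to \<open>- S\<close>, according to the sign of
    \<open>S k0\<close>.\<close>
  have *: "convergent T"
    if T: "\<And>k. T (Suc k) = T k + Z k" "\<And>k. T k * Z k \<le> 0"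
      "\<And>k. k \<ge> k0 \<Longrightarrow> \<bar>Z k\<bar> \<le> \<bar>T k\<bar>" "T k0 \<ge> 0" for T Z :: "nat \<Rightarrow> real"
  proof -
    \<comment> \<open>For \<open>T k = 0\<close> the opposition of signs gives nothing; there the
      bound of \<open>Z k\<close> by \<open>T k\<close> forces \<open>Z k = 0\<close>.\<close>
    have dec: "Z k \<le> 0" if "k \<ge> k0" "T k \<ge> 0" for k
      using T(2)[of k] T(3)[OF that(1)] that(2) by (cases "T k = 0") (auto simp: mult_le_0_iff)
    have nonneg: "T (k0 + i) \<ge> 0" for i
    proof (induction i)
      case (Suc i)
      then show ?case using T(3)[of "k0 + i"] T(1)[of "k0 + i"] by simp
    qed (use T(4) in simp)
    have "decseq (\<lambda>i. T (i + k0))"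
      using dec nonneg T(1) by (intro decseq_SucI) (simp add: add.commute)
    then obtain L where "(\<lambda>i. T (i + k0)) \<longlonglongrightarrow> L"
      using decseq_convergent[of "\<lambda>i. T (i + k0)" 0] nonneg by (metis add.commute)
    then show ?thesis by (metis LIMSEQ_offset convergent_def)
  qed
  show ?thesis
  proof (cases "S k0 \<ge> 0")
    case True
    then show ?thesis using *[of S X] step opp k0 by blast
  next
    case False
    then have "convergent (\<lambda>k. - S k)"
      using step opp k0 by (intro *[of "\<lambda>k. - S k" "\<lambda>k. - X k"]) auto
    then show ?thesis by (simp add: convergent_minus_iff[of S])
  qed
next
  case False
  have "S \<longlonglongrightarrow> 0"
  proof (rule LIMSEQ_I)
    fix e :: real assume "e > 0"
    then obtain N where N: "\<And>k. k \<ge> N \<Longrightarrow> \<bar>X k\<bar> < e"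
      using X by (auto simp: lim_sequentially dist_real_def)
    obtain k where k: "k \<ge> N" "\<bar>S k\<bar> < \<bar>X k\<bar>" using False by (meson not_le)
    \<comment> \<open>The jump over 0 at \<open>k\<close> lands within
      \<open>\<bar>X k\<bar> < e\<close> of 0. Afterwards sum and increment have opposite signs, so
      the next absolute value is at most the larger of theirs, and both are below
      \<open>e\<close>.\<close>
    have "\<bar>S (Suc k + i)\<bar> < e" for i
    proof (induction i)
      case 0
      then show ?case using k N[OF k(1)] opp[of k] step[of k]
        by (auto simp: mult_le_0_iff)
    next
      case (Suc i)
      then show ?case using k N[of "Suc k + i"] opp[of "Suc k + i"] step[of "Suc k + i"]
        by (auto simp: mult_le_0_iff)
    qed
    then show "\<exists>n0. \<forall>n\<ge>n0. norm (S n - 0) < e"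
      by (metis diff_zero le_Suc_ex real_norm_def)
  qed
  then show ?thesis by (rule convergentI)
qed

lemma sum_lessThan_add:
  fixes f :: "nat \<Rightarrow> 'a::comm_monoid_add"
  shows "sum f {..<p + n} = sum f {..<p} + (\<Sum>r<n. f (p + r))"
  by (induction n) (simp_all add: add.assoc)

text \<open>Between \<open>N\<close> and the last block end before it lie fewer than
  \<open>m\<close> terms. Their absolute sum is at most that of a whole block, which tends to 0
  because \<open>m\<close> is fixed.\<close>

lemma convergent_sum_blocks:
  fixes f :: "nat \<Rightarrow> real"
  assumes f: "f \<longlonglongrightarrow> 0" and m: "m > 0"
    and conv: "convergent (\<lambda>k. sum f {..<k * m})"
  shows "convergent (\<lambda>N. sum f {..<N})"
proof -
  obtain L where L: "(\<lambda>k. sum f {..<k * m}) \<longlonglongrightarrow> L" using conv by (auto simp: convergent_def)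
  have div: "filterlim (\<lambda>N. N div m) sequentially sequentially"
    unfolding filterlim_at_top eventually_sequentially
    using m by (metis div_le_mono nonzero_mult_div_cancel_right not_gr_zero)
  have T: "(\<lambda>k. \<Sum>r<m. \<bar>f (k * m + r)\<bar>) \<longlonglongrightarrow> 0"
  proof (rule tendsto_null_sum)
    fix r
    have "filterlim (\<lambda>k. k * m + r) sequentially sequentially"
      using m by (intro filterlim_subseq strict_monoI) auto
    then have "(\<lambda>k. f (k * m + r)) \<longlonglongrightarrow> 0" by (rule filterlim_compose[OF f])
    then show "(\<lambda>k. \<bar>f (k * m + r)\<bar>) \<longlonglongrightarrow> 0" by (rule tendsto_rabs_zero)
  qed
  have "(\<lambda>N. sum f {..<N} - sum f {..<N div m * m}) \<longlonglongrightarrow> 0"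
  proof (rule Lim_null_comparison[OF _ filterlim_compose[OF T div]], intro always_eventually allI)
    fix N
    have split: "sum f {..<N} = sum f {..<N div m * m} + (\<Sum>r<N mod m. f (N div m * m + r))"
      using sum_lessThan_add[of f "N div m * m" "N mod m"] by simp
    have "\<bar>\<Sum>r<N mod m. f (N div m * m + r)\<bar> \<le> (\<Sum>r<N mod m. \<bar>f (N div m * m + r)\<bar>)"
      by (rule sum_abs)
    also have "\<dots> \<le> (\<Sum>r<m. \<bar>f (N div m * m + r)\<bar>)"
      using m by (intro sum_mono2) (auto intro: less_trans mod_less_divisor)
    finally show "norm (sum f {..<N} - sum f {..<N div m * m})
        \<le> (\<Sum>r<m. \<bar>f (N div m * m + r)\<bar>)" by (simp add: split)
  qed
  from tendsto_add[OF this filterlim_compose[OF L div]] show ?thesis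
    by (auto simp: convergent_def)
qed

section \<open>Binary digits of real numbers\<close>

text \<open>Halving drops the last binary digit of the floor, so the parity of
  \<open>\<lfloor>2 ^ Suc j * x\<rfloor>\<close> is digit number \<open>Suc j\<close> of
  \<open>x\<close>. The recursion rebuilds the floors from the integer part and the digits.\<close>

lemma floor_power2_mult_Suc:
  fixes x :: real
  shows "\<lfloor>2 ^ Suc j * x\<rfloor> = 2 * \<lfloor>2 ^ j * x\<rfloor> + of_bool (odd \<lfloor>2 ^ Suc j * x\<rfloor>)"
proof -
  have "\<lfloor>2 ^ Suc j * x\<rfloor> div 2 = \<lfloor>2 ^ j * x\<rfloor>"
    using floor_divide_real_eq_div[of 2 "2 ^ Suc j * x"] by simp
  then show ?thesis by (metis mult_div_mod_eq of_bool_odd_eq_mod_2)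
qed

lemma floor_power2_mult_eqI:
  fixes x y :: real
  assumes "\<lfloor>x\<rfloor> = \<lfloor>y\<rfloor>"
    and "\<And>j. 1 \<le> j \<Longrightarrow> j \<le> J \<Longrightarrow> odd \<lfloor>2 ^ j * x\<rfloor> = odd \<lfloor>2 ^ j * y\<rfloor>"
  shows "\<lfloor>2 ^ J * x\<rfloor> = \<lfloor>2 ^ J * y\<rfloor>"
  using assms(2)
proof (induction J)
  case (Suc J)
  then have "\<lfloor>2 ^ J * x\<rfloor> = \<lfloor>2 ^ J * y\<rfloor>"
    and "odd \<lfloor>2 ^ Suc J * x\<rfloor> = odd \<lfloor>2 ^ Suc J * y\<rfloor>" by (auto simp del: power_Suc)
  then show ?case using floor_power2_mult_Suc[of J x] floor_power2_mult_Suc[of J y] by simp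
qed (use assms(1) in simp)

section \<open>Distance and common initial segments of sign sequences\<close>

lemma sign_dist_less_imp_eq:
  assumes "sign_dist x y < 2 powr - real n" "1 \<le> j" "j \<le> n"
  shows "x j = y j"
proof (rule ccontr)
  assume ne: "x j \<noteq> y j"
  then have "(LEAST n. n \<ge> 1 \<and> x n \<noteq> y n) \<le> j" using assms by (intro Least_le) auto
  then have "2 powr - real n \<le> sign_dist x y" using ne assms(3) by (auto simp: sign_dist_def)
  then show False using assms(1) by simp
qed

text \<open>By extensionality, distinct sign sequences differ at some positive index, so the
  \<open>LEAST\<close> in the distance is attained; agreement up to \<open>n\<close> pushes it to at
  least \<open>n + 1\<close>.\<close>

lemma sign_dist_leI:
  assumes "x \<in> sign_sequences" "y \<in> sign_sequences"
    and eq: "\<And>j. 1 \<le> j \<Longrightarrow> j \<le> n \<Longrightarrow> x j = y j"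
  shows "sign_dist x y \<le> 2 powr - (real n + 1)"
proof (cases "x = y")
  case False
  then have "\<exists>n. n \<ge> 1 \<and> x n \<noteq> y n"
    using assms(1,2) unfolding sign_sequences_def by (metis PiE_ext atLeast_iff)
  then have *: "(LEAST n. n \<ge> 1 \<and> x n \<noteq> y n) \<ge> 1
      \<and> x (LEAST n. n \<ge> 1 \<and> x n \<noteq> y n) \<noteq> y (LEAST n. n \<ge> 1 \<and> x n \<noteq> y n)"
    by (rule LeastI_ex)
  then have "(LEAST n. n \<ge> 1 \<and> x n \<noteq> y n) \<ge> Suc n" using eq not_less_eq_eq by blast
  then have "real (LEAST n. n \<ge> 1 \<and> x n \<noteq> y n) \<ge> real n + 1" by linarith
  then show ?thesis using False by (simp add: sign_dist_def)
qed (simp add: sign_dist_def)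

section \<open>Diameters and positivity of Hausdorff measure\<close>

context Metric_space
begin

lemma mdiam_leI:
  assumes "\<And>x y. x \<in> U \<Longrightarrow> y \<in> U \<Longrightarrow> d x y \<le> D"
  shows "mdiam U \<le> ennreal D"
  unfolding mdiam_def using assms by (intro SUP_least ennreal_leI) auto

lemma dist_le_mdiam:
  assumes "x \<in> U" "y \<in> U"
  shows "ennreal (d x y) \<le> mdiam U"
  unfolding mdiam_def using assms by (intro SUP_upper2[of x] SUP_upper2[of y]) auto

lemma mdiam_pow_le:
  assumes "0 < s" "0 \<le> D" "mdiam U \<le> ennreal D"
  shows "mdiam_pow s U \<le> ennreal (D powr s)"
proof -
  have "enn2real (mdiam U) \<le> D" using assms(2,3) by (simp add: enn2real_leI)
  then show ?thesis
    using assms(1) by (auto simp: mdiam_pow_def intro!: ennreal_leI powr_mono2)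
qed

text \<open>The mass distribution principle, for the image under \<open>g\<close> of a measure \<open>N\<close> on \<open>I\<close>. The
  map \<open>g\<close> need not be measurable, since only upper bounds for outer measures are required.\<close>

lemma hausdorff_measure_pos:
  assumes I: "I \<in> sets N" "emeasure N I \<noteq> 0" and g: "g ` I \<subseteq> A"
    and \<delta>: "\<delta> > 0"
    and mass: "\<And>U. \<lbrakk>U \<subseteq> M; mdiam U \<le> ennreal \<delta>\<rbrakk> \<Longrightarrow>
      \<exists>B\<in>sets N. {x \<in> I. g x \<in> U} \<subseteq> B \<and> emeasure N B \<le> ennreal C * mdiam_pow s U"
  shows "hausdorff_measure s A \<noteq> 0"
proof
  assume "hausdorff_measure s A = 0"
  then have pre: "hausdorff_premeasure s \<delta> A = 0"
    unfolding hausdorff_measure_def using \<delta> by (metis SUP_upper greaterThan_iff le_zero_eq)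
  have bound: "emeasure N I \<le> ennreal C * (\<Sum>i. mdiam_pow s (U i))"
    if U: "A \<subseteq> (\<Union>i. U i)" "\<And>i. U i \<subseteq> M \<and> mdiam (U i) \<le> ennreal \<delta>" for U :: "nat \<Rightarrow> 'a set"
  proof -
    have "\<forall>i. \<exists>B\<in>sets N. {x \<in> I. g x \<in> U i} \<subseteq> B
        \<and> emeasure N B \<le> ennreal C * mdiam_pow s (U i)"
      using mass U(2) by blast
    then obtain B where B: "\<And>i. B i \<in> sets N" "\<And>i. {x \<in> I. g x \<in> U i} \<subseteq> B i"
      "\<And>i. emeasure N (B i) \<le> ennreal C * mdiam_pow s (U i)" by metis
    have "I \<subseteq> (\<Union>i. B i)" using g U(1) B(2) by blast
    then have "emeasure N I \<le> emeasure N (\<Union>i. B i)" using B(1) by (intro emeasure_mono) auto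
    also have "\<dots> \<le> (\<Sum>i. emeasure N (B i))"
      using B(1) by (intro emeasure_subadditive_countably) auto
    also have "\<dots> \<le> (\<Sum>i. ennreal C * mdiam_pow s (U i))"
      using B(3) by (intro suminf_le) auto
    finally show ?thesis by simp
  qed
  \<comment> \<open>A bound for cover sums that is too small to carry the mass of \<open>I\<close>.
    Going through \<open>e\<close> strictly below that mass also handles infinite mass; for
    \<open>C \<le> 0\<close> the factor \<open>ennreal C\<close> is 0.\<close>
  obtain c where c: "0 < c" "ennreal C * c < emeasure N I"
  proof (cases "C > 0")
    case True
    obtain e where e: "0 < e" "e < emeasure N I" using I(2) by (metis dense gr_zeroI)
    have "ennreal C * (e / ennreal C) = e"
      using True by (simp add: ennreal_times_divide ennreal_mult_divide_eq mult.commute)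
    then show ?thesis using that[of "e / ennreal C"] e by (simp add: ennreal_zero_less_divide)
  next
    case False
    then show ?thesis using that[of 1] I(2) by (simp add: ennreal_neg zero_less_iff_neq_zero)
  qed
  have "hausdorff_premeasure s \<delta> A < c" using pre c by simp
  then obtain U where U: "A \<subseteq> (\<Union>i. U i)" "\<And>i. U i \<subseteq> M \<and> mdiam (U i) \<le> ennreal \<delta>"
    and "(\<Sum>i. mdiam_pow s (U i)) < c"
    unfolding hausdorff_premeasure_def by (auto simp: INF_less_iff)
  then have "emeasure N I \<le> ennreal C * c"
    using bound[OF U] by (meson dual_order.trans less_imp_le mult_left_mono zero_le)
  then show False using c(2) by simp
qed

end

section \<open>Covers by cylinders and the upper bound\<close>

text \<open>The sets are the cylinders that fix the first \<open>n\<close> signs, enumerated by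
  \<open>h\<close>. Two members of one cylinder first differ at index \<open>n + 1\<close> or later.
  Empty sets pad the finite cover to a sequence, as the premeasure demands.\<close>

lemma sign_cylinder_cover:
  obtains U :: "nat \<Rightarrow> (nat \<Rightarrow> real) set"
  where "sign_sequences \<subseteq> (\<Union>i. U i)"
    "\<And>i. U i \<subseteq> sign_sequences"
    "\<And>i. sign_seq.mdiam (U i) \<le> ennreal (2 powr - (real n + 1))"
    "\<And>i::nat. i \<ge> 2 ^ n \<Longrightarrow> U i = {}"
proof -
  define G where "G = ({1..n} \<rightarrow>\<^sub>E {-1, 1::real})"
  have "finite G" "card G = 2 ^ n" unfolding G_def by (simp_all add: finite_PiE card_PiE numeral_2_eq_2)
  then obtain h where h: "bij_betw h {0::nat..<2 ^ n} G" by (metis ex_bij_betw_nat_finite)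
  define U where
    "U i = {\<epsilon> \<in> sign_sequences. i < 2 ^ n \<and> (\<forall>j\<in>{1..n}. \<epsilon> j = h i j)}" for i
  show ?thesis
  proof
    show "sign_sequences \<subseteq> (\<Union>i. U i)"
    proof
      fix \<epsilon> assume \<epsilon>: "\<epsilon> \<in> sign_sequences"
      then have "restrict \<epsilon> {1..n} \<in> G" by (auto simp: G_def sign_sequences_def)
      then obtain i where "i < 2 ^ n" "h i = restrict \<epsilon> {1..n}"
        using h by (metis atLeastLessThan_iff bij_betw_imp_surj_on imageE)
      then show "\<epsilon> \<in> (\<Union>i. U i)" using \<epsilon> by (auto simp: U_def)
    qed
    show "sign_seq.mdiam (U i) \<le> ennreal (2 powr - (real n + 1))" for i
      by (intro sign_seq.mdiam_leI sign_dist_leI) (auto simp: U_def)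
  qed (auto simp: U_def)
qed

text \<open>The \<open>2 ^ n\<close> cylinders contribute at most
  \<open>2 powr (- (n + 1) * s)\<close> each. The total is at most
  \<open>(2 powr (1 - s)) ^ n\<close>, which tends to 0 for \<open>s > 1\<close>.\<close>

lemma hausdorff_measure_sign_sequences_eq_0:
  assumes A: "A \<subseteq> sign_sequences" and s: "s > 1"
  shows "sign_seq.hausdorff_measure s A = 0"
proof -
  have "sign_seq.hausdorff_premeasure s \<delta> A \<le> 0" if \<delta>: "\<delta> > 0" for \<delta>
  proof -
    have bound: "sign_seq.hausdorff_premeasure s \<delta> A \<le> ennreal ((2 powr (1 - s)) ^ n)"
      if n: "2 powr - (real n + 1) \<le> \<delta>" for n
    proof -
      obtain U where U: "sign_sequences \<subseteq> (\<Union>i. U i)" "\<And>i. U i \<subseteq> sign_sequences"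
        "\<And>i. sign_seq.mdiam (U i) \<le> ennreal (2 powr - (real n + 1))"
        "\<And>i::nat. i \<ge> 2 ^ n \<Longrightarrow> U i = {}" using sign_cylinder_cover[of n] by blast
      have "sign_seq.hausdorff_premeasure s \<delta> A \<le> (\<Sum>i. sign_seq.mdiam_pow s (U i))"
        unfolding sign_seq.hausdorff_premeasure_def
        using A U(1,2) order_trans[OF U(3) ennreal_leI[OF n]] by (intro INF_lower) auto
      also have "\<dots> = (\<Sum>i<2 ^ n::nat. sign_seq.mdiam_pow s (U i))"
        using U(4) by (intro suminf_finite) (auto simp: sign_seq.mdiam_pow_def)
      also have "\<dots> \<le> (\<Sum>i<2 ^ n::nat. ennreal ((2 powr - (real n + 1)) powr s))"
        using U(3) s by (intro sum_mono sign_seq.mdiam_pow_le) auto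
      also have "\<dots> = ennreal (2 ^ n * 2 powr (- (real n + 1) * s))"
        by (simp add: powr_powr ennreal_mult ennreal_power[symmetric])
      also have "\<dots> \<le> ennreal ((2 powr (1 - s)) ^ n)"
      proof (rule ennreal_leI)
        have "2 ^ n * 2 powr (- (real n + 1) * s) = 2 powr (real n + - (real n + 1) * s)"
          by (simp add: powr_add powr_realpow)
        also have "\<dots> \<le> 2 powr (real n * (1 - s))"
          using s by (intro powr_mono) (auto simp: algebra_simps)
        also have "\<dots> = (2 powr (1 - s)) ^ n"
          by (simp add: powr_powr powr_realpow[symmetric] mult.commute)
        finally show "2 ^ n * 2 powr (- (real n + 1) * s) \<le> (2 powr (1 - s)) ^ n" .
      qed
      finally show ?thesis .
    qed
    have "(\<lambda>n. (1/2::real) ^ n) \<longlonglongrightarrow> 0" by (rule LIMSEQ_realpow_zero) auto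
    then have "\<forall>\<^sub>F n in sequentially. (1/2) ^ n < \<delta>" using \<delta> by (rule order_tendstoD)
    then have ev: "\<forall>\<^sub>F n in sequentially. 2 powr - (real n + 1) \<le> \<delta>"
    proof eventually_elim
      case (elim n)
      have "2 powr - (real n + 1) \<le> 2 powr - real n" by simp
      also have "\<dots> = (1/2) ^ n" by (simp add: powr_minus powr_realpow divide_simps)
      finally show ?case using elim by simp
    qed
    have "2 powr (1 - s) < 1" using s by (simp add: powr_less_one)
    then have "(\<lambda>n. ennreal ((2 powr (1 - s)) ^ n)) \<longlonglongrightarrow> ennreal 0"
      by (intro tendsto_ennrealI LIMSEQ_realpow_zero) auto
    then have "sign_seq.hausdorff_premeasure s \<delta> A \<le> ennreal 0"
      by (rule tendsto_lowerbound)
        (use eventually_mono[OF ev bound] in auto)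
    then show ?thesis by simp
  qed
  then show ?thesis
    unfolding sign_seq.hausdorff_measure_def by (intro antisym SUP_least) auto
qed

section \<open>Lower bound from an encoding of binary digits by signs\<close>

text \<open>If \<open>K\<close> blocks of \<open>q + 1\<close> signs determine \<open>K * q\<close>
  binary digits, then a set of diameter about \<open>2 powr - (K * (q + 1))\<close> has a preimage
  of length about \<open>2 powr - (K * q)\<close>. This is the mass bound for exponents up to
  \<open>q / (q + 1)\<close>.\<close>

lemma hausdorff_measure_pos_of_digits:
  assumes s: "0 \<le> s" "s * (real q + 1) \<le> real q" and q: "q > 0"
    and g: "g ` {0..<1} \<subseteq> A"
    and digits: "\<And>x y K. \<lbrakk>x \<in> {0..<1}; y \<in> {0..<1};
        \<And>j. 1 \<le> j \<Longrightarrow> j \<le> K * Suc q \<Longrightarrow> g x j = g y j\<rbrakk>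
      \<Longrightarrow> \<lfloor>2 ^ (K * q) * x\<rfloor> = \<lfloor>2 ^ (K * q) * (y::real)\<rfloor>"
  shows "sign_seq.hausdorff_measure s A \<noteq> 0"
\<comment> \<open>The constant \<open>C\<close> absorbs the factor of at most \<open>2 ^ q\<close>
  lost by rounding to whole blocks. The choice of \<open>\<delta>\<close> keeps
  \<open>- log 2 D\<close> at least 1 for positive diameters \<open>D\<close>.\<close>
proof (rule sign_seq.hausdorff_measure_pos[where I = "{0..<1::real}" and N = lborel and \<delta> = "1/2"
      and C = "2 ^ (q + 2)", OF _ _ g])
  fix U :: "(nat \<Rightarrow> real) set"
  assume "U \<subseteq> sign_sequences" and diam: "sign_seq.mdiam U \<le> ennreal (1/2)"
  define D where "D = enn2real (sign_seq.mdiam U)"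
  have fin: "sign_seq.mdiam U = ennreal D"
    using diam by (metis D_def ennreal_enn2real ennreal_less_top le_less_trans)
  have D: "0 \<le> D" "D \<le> 1/2" using enn2real_leI[OF _ diam] by (simp_all add: D_def)
  have dist: "sign_dist u v \<le> D" if "u \<in> U" "v \<in> U" for u v
    using sign_seq.dist_le_mdiam[OF that] D(1) by (simp add: fin)
  \<comment> \<open>Points of \<open>U\<close> agree on the first \<open>K\<close> blocks, so their
    preimages share \<open>K * q\<close> binary digits and lie in one dyadic interval.\<close>
  have interval: "\<exists>B\<in>sets lborel. {x \<in> {0..<1}. g x \<in> U} \<subseteq> B
      \<and> emeasure lborel B \<le> ennreal (1 / 2 ^ (K * q))"
    if K: "D < 2 powr - real (K * Suc q)" for K
  proof (cases "{x \<in> {0..<1}. g x \<in> U} = {}")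
    case False
    then obtain y where y: "y \<in> {0..<1}" "g y \<in> U" by auto
    define k where "k = \<lfloor>2 ^ (K * q) * y\<rfloor>"
    have "{x \<in> {0..<1}. g x \<in> U} \<subseteq> {real_of_int k / 2 ^ (K * q) .. (real_of_int k + 1) / 2 ^ (K * q)}"
    proof
      fix x assume x: "x \<in> {x \<in> {0..<1}. g x \<in> U}"
      have "sign_dist (g x) (g y) < 2 powr - real (K * Suc q)"
        using dist[of "g x" "g y"] x y K by auto
      then have "\<lfloor>2 ^ (K * q) * x\<rfloor> = k"
        unfolding k_def using x y by (intro digits sign_dist_less_imp_eq) auto
      then have "real_of_int k \<le> 2 ^ (K * q) * x" "2 ^ (K * q) * x \<le> real_of_int k + 1"
        by linarith+
      then show "x \<in> {real_of_int k / 2 ^ (K * q) .. (real_of_int k + 1) / 2 ^ (K * q)}"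
        by (simp add: field_simps)
    qed
    then show ?thesis
      by (intro bexI[of _ "{real_of_int k / 2 ^ (K * q) .. (real_of_int k + 1) / 2 ^ (K * q)}"])
        (auto simp: divide_right_mono diff_divide_distrib[symmetric])
  qed (auto intro: bexI[of _ "{}"])
  show "\<exists>B\<in>sets lborel. {x \<in> {0..<1}. g x \<in> U} \<subseteq> B
      \<and> emeasure lborel B \<le> ennreal (2 ^ (q + 2)) * sign_seq.mdiam_pow s U"
  proof (cases "U = {}")
    case True
    then show ?thesis by (intro bexI[of _ "{}"]) auto
  next
    case U: False
    show ?thesis
    proof (cases "s = 0")
      case True
      \<comment> \<open>At exponent 0 the nonempty set \<open>U\<close> counts as 1, and the
        interval for \<open>K = 0\<close>, of length 1, suffices.\<close>
      then have "sign_seq.mdiam_pow s U = 1" using U by (simp add: sign_seq.mdiam_pow_def)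
      moreover have "ennreal (1 / 2 ^ (0 * q)) \<le> ennreal (2 ^ (q + 2))"
        by (intro ennreal_leI) (use one_le_power[of "2::real" "q+2"] in simp)
      moreover have "D < 2 powr - real (0 * Suc q)" using D by simp
      then obtain B where "B \<in> sets lborel" "{x \<in> {0..<1}. g x \<in> U} \<subseteq> B"
        "emeasure lborel B \<le> ennreal (1 / 2 ^ (0 * q))" using interval[of 0] by blast
      ultimately show ?thesis
        by (intro bexI[of _ B] conjI) (auto simp del: power_Suc intro: order_trans)
    next
      case False
      then have pow: "sign_seq.mdiam_pow s U = ennreal (D powr s)"
        using U by (simp add: sign_seq.mdiam_pow_def D_def)
      show ?thesis
      proof (cases "D = 0")
        case True
        \<comment> \<open>Diameter 0 allows every \<open>K\<close>. The intersection of the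
          resulting sets is a null set because \<open>q > 0\<close>.\<close>
        then have "\<exists>B\<in>sets lborel. {x \<in> {0..<1}. g x \<in> U} \<subseteq> B
          \<and> emeasure lborel B \<le> ennreal (1 / 2 ^ (K * q))" for K
          using interval by simp
        then obtain B where B: "\<And>K. B K \<in> sets lborel" "\<And>K. {x \<in> {0..<1}. g x \<in> U} \<subseteq> B K"
          "\<And>K. emeasure lborel (B K) \<le> ennreal (1 / 2 ^ (K * q))" by metis
        have "(\<lambda>K. ennreal ((1 / 2 ^ q) ^ K)) \<longlonglongrightarrow> ennreal 0"
          using q by (intro tendsto_ennrealI LIMSEQ_realpow_zero) auto
        then have "emeasure lborel (\<Inter>K. B K) \<le> ennreal 0"
        proof (rule tendsto_lowerbound)
          show "\<forall>\<^sub>F K in sequentially. emeasure lborel (\<Inter>K. B K) \<le> ennreal ((1 / 2 ^ q) ^ K)"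
          proof (intro always_eventually allI)
            fix K
            have "emeasure lborel (\<Inter>K. B K) \<le> emeasure lborel (B K)"
              using B(1) by (intro emeasure_mono) auto
            also have "\<dots> \<le> ennreal ((1 / 2 ^ q) ^ K)"
              using B(3)[of K] by (simp add: power_mult[symmetric] power_divide mult.commute)
            finally show "emeasure lborel (\<Inter>K. B K) \<le> ennreal ((1 / 2 ^ q) ^ K)" .
          qed
        qed auto
        moreover have "(\<Inter>K. B K) \<in> sets lborel" using B(1) by blast
        ultimately show ?thesis using B(2) by (intro bexI[of _ "\<Inter>K. B K"]) auto
      next
        case False
        then have Dpos: "D > 0" using D by simp
        \<comment> \<open>This \<open>n\<close> satisfies
          \<open>2 powr - (n + 1) \<le> D < 2 powr - n\<close>. Ceiling minus 1 instead of floor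
          keeps the second inequality strict when \<open>D\<close> is a power of 2, as
          \<open>interval\<close> requires; \<open>D \<le> 1/2\<close> ensures that
          \<open>nat\<close> truncates nothing.\<close>
        define n where "n = nat (\<lceil>- log 2 D\<rceil> - 1)"
        have "log 2 D \<le> -1" using D Dpos by (simp add: log_le_iff powr_minus_divide)
        then have "real n = of_int \<lceil>- log 2 D\<rceil> - 1" by (simp add: n_def le_ceiling_iff)
        then have n: "real n < - log 2 D" "- log 2 D \<le> real n + 1" by linarith+
        define K where "K = n div Suc q"
        have "K * Suc q \<le> n" by (simp add: K_def del: mult_Suc_right)
        then have "log 2 D < - real (K * Suc q)" using n(1) by linarith
        then have "D < 2 powr - real (K * Suc q)" using Dpos by (simp add: log_less_iff)
        from interval[OF this] obtain B where B: "B \<in> sets lborel"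
          "{x \<in> {0..<1}. g x \<in> U} \<subseteq> B" "emeasure lborel B \<le> ennreal (1 / 2 ^ (K * q))" by auto
        have "n < Suc q + K * Suc q" unfolding K_def by (rule dividend_less_div_times) simp
        then have nK: "real n \<le> (real q + 1) * real K + real q"
          using of_nat_mono[of n "Suc q * K + q", where ?'a = real] by (simp add: algebra_simps)
        \<comment> \<open>The hypothesis \<open>s * (q + 1) \<le> q\<close> enters twice: for the
          \<open>K\<close> full blocks and for the incomplete block together with the rounding of
          \<open>D\<close>.\<close>
        have "s * - log 2 D \<le> s * ((real q + 1) * real K + real q + 1)"
          using n(2) nK s(1) by (intro mult_left_mono) auto
        also have "\<dots> = (s * (real q + 1)) * real K + s * (real q + 1)" by (simp add: algebra_simps)
        also have "\<dots> \<le> real q * real K + real q" using s(2) by (intro add_mono mult_right_mono) auto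
        finally have "- (real K * real q) \<le> real (q + 2) + s * log 2 D" by (simp add: algebra_simps)
        then have "2 powr - (real (K * q)) \<le> 2 powr (real (q + 2) + log 2 D * s)"
          by (simp add: mult.commute)
        also have "\<dots> = 2 powr real (q + 2) * (2 powr log 2 D) powr s"
          by (simp only: powr_add powr_powr)
        also have "\<dots> = 2 ^ (q + 2) * D powr s"
          using Dpos by (subst powr_realpow) auto
        finally have "1 / 2 ^ (K * q) \<le> 2 ^ (q + 2) * D powr s"
          by (subst (asm) powr_minus, subst (asm) powr_realpow) (auto simp: divide_simps)
        then have "ennreal (1 / 2 ^ (K * q)) \<le> ennreal (2 ^ (q + 2)) * ennreal (D powr s)"
          by (subst ennreal_mult[symmetric]) (auto intro: ennreal_leI)
        then show ?thesis using B pow by (auto intro: order_trans)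
      qed
    qed
  qed
qed auto

section \<open>Signs that balance the block sums\<close>

primrec balanced_sum :: "(nat \<Rightarrow> real) \<Rightarrow> nat \<Rightarrow> real" where
  "balanced_sum Y 0 = 0"
| "balanced_sum Y (Suc k) =
     balanced_sum Y k + (if balanced_sum Y k * Y k \<le> 0 then Y k else - Y k)"

text \<open>The case distinction, unlike \<open>sgn\<close>, yields a sign even when the product is
  0, so a flip is always its own inverse.\<close>

definition flip_sign :: "(nat \<Rightarrow> real) \<Rightarrow> nat \<Rightarrow> real" where
  "flip_sign Y k = (if balanced_sum Y k * Y k \<le> 0 then 1 else -1)"

lemma balanced_sum_Suc: "balanced_sum Y (Suc k) = balanced_sum Y k + flip_sign Y k * Y k"
  by (simp add: flip_sign_def)

lemma convergent_balanced_sum: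
  assumes "Y \<longlonglongrightarrow> 0"
  shows "convergent (balanced_sum Y)"
proof (rule convergent_opposing_increments)
  show "balanced_sum Y (Suc k) = balanced_sum Y k + flip_sign Y k * Y k" for k
    by (rule balanced_sum_Suc)
  show "balanced_sum Y k * (flip_sign Y k * Y k) \<le> 0" for k
    by (simp add: flip_sign_def)
  show "(\<lambda>k. flip_sign Y k * Y k) \<longlonglongrightarrow> 0"
    by (rule Lim_null_comparison[OF _ tendsto_rabs_zero[OF assms]]) (simp add: flip_sign_def abs_mult)
qed

text \<open>Indices are shifted to start at 0 here. The sign at the start of each block
  of length \<open>Suc q\<close> is 1, and the other \<open>q\<close> signs are consecutive binary digits of \<open>x\<close>.\<close>

definition digit_signs :: "nat \<Rightarrow> real \<Rightarrow> nat \<Rightarrow> real" where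
  "digit_signs q x i =
     (if i mod Suc q = 0 \<or> odd \<lfloor>2 ^ (i div Suc q * q + i mod Suc q) * x\<rfloor> then 1 else -1)"

definition block_sum :: "(nat \<Rightarrow> real) \<Rightarrow> nat \<Rightarrow> real \<Rightarrow> nat \<Rightarrow> real" where
  "block_sum b q x k = (\<Sum>r<Suc q. digit_signs q x (k * Suc q + r) * b (k * Suc q + r))"

definition balanced_signs :: "(nat \<Rightarrow> real) \<Rightarrow> nat \<Rightarrow> real \<Rightarrow> nat \<Rightarrow> real" where
  "balanced_signs b q x i = flip_sign (block_sum b q x) (i div Suc q) * digit_signs q x i"

lemma abs_digit_signs [simp]: "\<bar>digit_signs q x i\<bar> = 1"
  by (simp add: digit_signs_def)

lemma balanced_signs_cases: "balanced_signs b q x i \<in> {-1, 1}"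
  by (auto simp: balanced_signs_def flip_sign_def digit_signs_def)

lemma abs_balanced_signs [simp]: "\<bar>balanced_signs b q x i\<bar> = 1"
  using balanced_signs_cases[of b q x i] by auto

lemma block_sum_tendsto_0:
  assumes b: "b \<longlonglongrightarrow> 0"
  shows "block_sum b q x \<longlonglongrightarrow> 0"
  unfolding block_sum_def
proof (rule tendsto_null_sum)
  fix r
  have "filterlim (\<lambda>k. k * Suc q + r) sequentially sequentially"
    by (intro filterlim_subseq strict_monoI add_strict_right_mono mult_strict_right_mono) auto
  then have "(\<lambda>k. \<bar>b (k * Suc q + r)\<bar>) \<longlonglongrightarrow> 0"
    by (intro tendsto_rabs_zero filterlim_compose[OF b])
  then show "(\<lambda>k. digit_signs q x (k * Suc q + r) * b (k * Suc q + r)) \<longlonglongrightarrow> 0"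
    by (rule Lim_null_comparison[rotated]) (simp add: abs_mult)
qed

text \<open>The flip is constant on a block and factors out of its sum. Hence the recursively
  defined sums that govern the flips are the actual partial sums at block ends.\<close>

lemma sum_balanced_signs:
  "(\<Sum>i<k * Suc q. balanced_signs b q x i * b i) = balanced_sum (block_sum b q x) k"
proof (induction k)
  case (Suc k)
  have "(\<Sum>i<Suc k * Suc q. balanced_signs b q x i * b i) = balanced_sum (block_sum b q x) k
      + (\<Sum>r<Suc q. balanced_signs b q x (k * Suc q + r) * b (k * Suc q + r))"
    using sum_lessThan_add[of "\<lambda>i. balanced_signs b q x i * b i" "k * Suc q" "Suc q"] Suc
    by (simp only: mult_Suc add.commute)
  also have "(\<Sum>r<Suc q. balanced_signs b q x (k * Suc q + r) * b (k * Suc q + r))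
      = flip_sign (block_sum b q x) k * block_sum b q x k"
    unfolding block_sum_def[of b q x k] sum_distrib_left
  proof (rule sum.cong)
    fix r assume "r \<in> {..<Suc q}"
    then have "(k * Suc q + r) div Suc q = k" by (intro div_nat_eqI) auto
    then show "balanced_signs b q x (k * Suc q + r) * b (k * Suc q + r)
        = flip_sign (block_sum b q x) k * (digit_signs q x (k * Suc q + r) * b (k * Suc q + r))"
      by (simp only: balanced_signs_def mult.assoc)
  qed simp
  finally show ?case by (simp only: balanced_sum_Suc)
qed simp

lemma convergent_balanced_signs:
  assumes "b \<longlonglongrightarrow> 0"
  shows "convergent (\<lambda>N. \<Sum>i<N. balanced_signs b q x i * b i)"
proof (rule convergent_sum_blocks[of _ "Suc q"])
  show "(\<lambda>i. balanced_signs b q x i * b i) \<longlonglongrightarrow> 0"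
    by (rule Lim_null_comparison[OF _ tendsto_rabs_zero[OF assms]]) (simp add: abs_mult)
  show "convergent (\<lambda>k. \<Sum>i<k * Suc q. balanced_signs b q x i * b i)"
    unfolding sum_balanced_signs
    using convergent_balanced_sum[OF block_sum_tendsto_0[OF assms]] by simp
qed simp

text \<open>The flip of a block can be read off its first sign.\<close>

lemma digit_signs_eq_balanced_signs:
  "digit_signs q x i = balanced_signs b q x (i div Suc q * Suc q) * balanced_signs b q x i"
proof -
  have "digit_signs q x (i div Suc q * Suc q) = 1" by (simp add: digit_signs_def del: mult_Suc_right)
  moreover have "flip_sign Y k * flip_sign Y k = 1" for Y k by (simp add: flip_sign_def)
  ultimately show ?thesis by (simp add: balanced_signs_def del: mult_Suc_right)
qed

text \<open>Undoing the flips recovers the digit signs of the first \<open>K\<close> blocks, hence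
  \<open>K * q\<close> binary digits; the integer parts are both 0.\<close>

lemma balanced_signs_determine_floor:
  assumes x: "x \<in> {0..<1}" and y: "y \<in> {0..<1}"
    and eq: "\<And>i. i < K * Suc q \<Longrightarrow> balanced_signs b q x i = balanced_signs b q y i"
  shows "\<lfloor>2 ^ (K * q) * x\<rfloor> = \<lfloor>2 ^ (K * q) * y\<rfloor>"
proof (rule floor_power2_mult_eqI)
  have "\<lfloor>x\<rfloor> = 0" "\<lfloor>y\<rfloor> = 0" using x y by (simp_all add: floor_eq_iff)
  then show "\<lfloor>x\<rfloor> = \<lfloor>y\<rfloor>" by simp
  fix j assume j: "1 \<le> j" "j \<le> K * q"
  then have q: "q > 0" by (cases q) auto
  \<comment> \<open>Digit \<open>j\<close> sits in block \<open>k\<close> at position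
    \<open>r\<close>. Positions run from 1 to \<open>q\<close> because position 0 holds the sign
    that records the flip, hence the shift by 1.\<close>
  define k r where "k = (j - 1) div q" and "r = Suc ((j - 1) mod q)"
  have jkr: "j = k * q + r" using j by (simp add: k_def r_def)
  have "k < K" using j q by (simp add: k_def less_mult_imp_div_less)
  have r: "1 \<le> r" "r < Suc q" using q by (simp_all add: r_def)
  define i where "i = k * Suc q + r"
  have ik: "i div Suc q = k" "i mod Suc q = r"
    unfolding i_def using r by (auto intro: div_nat_eqI simp del: mult_Suc_right)
  have "i < Suc k * Suc q" using r by (simp add: i_def)
  also have "\<dots> \<le> K * Suc q" using \<open>k < K\<close> by (intro mult_right_mono) auto
  finally have i: "i < K * Suc q" .
  \<comment> \<open>The start of the block is also among the indices where the signs agree, so both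
    sequences have the same flip there.\<close>
  have "i div Suc q * Suc q < K * Suc q" using i by (meson div_times_less_eq_dividend le_less_trans)
  then have "digit_signs q x i = digit_signs q y i"
    using eq i digit_signs_eq_balanced_signs by metis
  then show "odd \<lfloor>2 ^ j * x\<rfloor> = odd \<lfloor>2 ^ j * y\<rfloor>"
    using r unfolding digit_signs_def ik jkr by (simp split: if_splits)
qed

theorem theorem1p1:
  fixes a :: "nat \<Rightarrow> real"
  assumes "a \<longlonglongrightarrow> 0"
  shows "sign_seq.hausdorff_dim
           {\<epsilon> \<in> sign_sequences. convergent (\<lambda>N. \<Sum>n=1..N. \<epsilon> n * a n)} = 1"
    (is "sign_seq.hausdorff_dim ?A = 1")
proof (rule antisym)
  show "sign_seq.hausdorff_dim ?A \<le> 1"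
  proof (rule ennreal_le_epsilon)
    fix e :: real assume "e > 0"
    then have "sign_seq.hausdorff_measure (1 + e) ?A = 0"
      by (intro hausdorff_measure_sign_sequences_eq_0) auto
    then have "sign_seq.hausdorff_dim ?A \<le> ennreal (1 + e)"
      unfolding sign_seq.hausdorff_dim_def using \<open>e > 0\<close>
      by (intro Inf_lower CollectI exI[of _ "1 + e"]) auto
    then show "sign_seq.hausdorff_dim ?A \<le> 1 + ennreal e" using \<open>e > 0\<close> by simp
  qed
  show "1 \<le> sign_seq.hausdorff_dim ?A"
    unfolding sign_seq.hausdorff_dim_def
  proof (rule Inf_greatest)
    fix t assume "t \<in> {ennreal s |s. 0 \<le> s \<and> sign_seq.hausdorff_measure s ?A = 0}"
    then obtain s where t: "t = ennreal s" and s: "0 \<le> s" "sign_seq.hausdorff_measure s ?A = 0"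
      by auto
    have "s \<ge> 1"
    proof (rule ccontr)
      assume "\<not> s \<ge> 1"
      \<comment> \<open>For \<open>s < 1\<close> the condition \<open>q > s / (1 - s)\<close> is
        equivalent to \<open>s < q / (q + 1)\<close>.\<close>
      then obtain q :: nat where q0: "real q > s / (1 - s)" "q > 0"
        by (metis gr_implies_not_zero gr_zeroI less_trans of_nat_0 reals_Archimedean2
            zero_less_Suc lessI of_nat_less_iff)
      then have q: "s * (real q + 1) \<le> real q" using \<open>\<not> s \<ge> 1\<close> by (simp add: field_simps)
      \<comment> \<open>The block construction counts from 0 and the series from 1; \<open>g\<close>
        shifts back and takes the value \<open>undefined\<close> at 0 that extensional sequences
        must have.\<close>
      define b where "b i = a (Suc i)" for i
      have b: "b \<longlonglongrightarrow> 0" unfolding b_def using assms by (rule LIMSEQ_Suc)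
      define g where
        "g x n = (if n = 0 then undefined else balanced_signs b q x (n - 1))" for x n
      have "sign_seq.hausdorff_measure s ?A \<noteq> 0"
      proof (rule hausdorff_measure_pos_of_digits[OF s(1) q q0(2), where g = g])
        have "g x \<in> sign_sequences" for x
          using balanced_signs_cases by (auto simp: sign_sequences_def g_def PiE_iff extensional_def)
        moreover have "convergent (\<lambda>N. \<Sum>n=1..N. g x n * a n)" for x
          using convergent_balanced_signs[OF b, of q x]
          by (simp add: sum.atLeast1_atMost_eq g_def b_def)
        ultimately show "g ` {0..<1} \<subseteq> ?A" by blast
      next
        fix x y :: real and K :: nat
        assume xy: "x \<in> {0..<1}" "y \<in> {0..<1}"
          and eq: "\<And>j. 1 \<le> j \<Longrightarrow> j \<le> K * Suc q \<Longrightarrow> g x j = g y j"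
        have "balanced_signs b q x i = balanced_signs b q y i" if "i < K * Suc q" for i
          using eq[of "Suc i"] that by (simp add: g_def)
        then show "\<lfloor>2 ^ (K * q) * x\<rfloor> = \<lfloor>2 ^ (K * q) * y\<rfloor>"
          by (rule balanced_signs_determine_floor[OF xy])
      qed
      then show False using s(2) by simp
    qed
    then show "1 \<le> t" using t by simp
  qed
qed

end
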